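(* Let $G=(V,E)$ be a finite simple undirected graph, let $\{\eta_0(u)\}_{u\in V}$ be an initial water profile with values in $[0,c]$, and let $v\in V$ be a fixed target vertex. Then the supremum $\kappa(v)$ of attainable water levels at $v$ can be achieved with a finite number of hypermoves; that is, there is a finite sequence of moves, each of which is a single-edge move or a hypermove, which started from the profile $\eta_0$ results in a terminal profile $\eta_t$ with $\eta_t(v)=\kappa(v)$.
   Context: Fix a capacity $c>0$. A water profile on $G=(V,E)$ is a function $\eta\in[0,c]^V$. A (single-edge) move is a pair $(e,\mu)$ with $e=\langle x,y\rangle\in E$ and $\mu\in[0,\tfrac12]$; it transforms a profile $\eta_k$ into $\eta_{k+1}$ given by $\eta_{k+1}(x)=\eta_k(x)+\mu(\eta_k(y)-\eta_k(x))$, $\eta_{k+1}(y)=\eta_k(y)+\mu(\eta_k(x)-\eta_k(y))$, and $\eta_{k+1}(u)=\eta_k(u)$ for $u\in V\setminus\{x,y\}$. A finite move sequence is a finite (possibly empty) list $((e_1,\mu_1),\dots,(e_t,\mu_t))\in(E\times[0,\frac12])^t$ of single-edge moves, applied one after another to $\eta_0$. For a target vertex $v$, $\kappa(v)$ denotes the supremum, over all finite move sequences (consisting of single-edge moves only), of the resulting water level $\eta_t(v)$ at $v$. A hypermove is given by a set $A\subseteq V$ with $|A|\ge 3$, a set $E_A\subseteq E$ of edges with both endpoints in $A$ such that the graph $(A,E_A)$ is connected, and $\mu\in[0,\tfrac12]$; it transforms a profile $\eta_{k-1}$ into $\eta_k$ given by $\eta_k(u)=(1-2\mu)\,\eta_{k-1}(u)+2\mu\,\overline{\eta}_{k-1}(A)$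 for $u\in A$, where $\overline{\eta}_{k-1}(A)=\frac1{|A|}\sum_{w\in A}\eta_{k-1}(w)$, and $\eta_k(u)=\eta_{k-1}(u)$ for $u\notin A$. *)

theory Defs
  imports Complex_Main
begin

definition simple_graph :: "'a set \<Rightarrow> 'a set set \<Rightarrow> bool" where
  "simple_graph V E \<longleftrightarrow> (\<forall>e\<in>E. e \<subseteq> V \<and> card e = 2)"

definition connected_graph :: "'a set \<Rightarrow> 'a set set \<Rightarrow> bool" where
  "connected_graph A F \<longleftrightarrow>
     simple_graph A F \<and> A \<noteq> {} \<and> (\<forall>u\<in>A. \<forall>w\<in>A. (u, w) \<in> {(x, y). {x, y} \<in> F}\<^sup>*)"

text \<open>A profile is a total function, but only its values on the vertex set matter.\<close>

definition water_profile :: "'a set \<Rightarrow> real \<Rightarrow> ('a \<Rightarrow> real) \<Rightarrow> bool" where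
  "water_profile V c \<eta> \<longleftrightarrow> (\<forall>u\<in>V. \<eta> u \<in> {0..c})"

text \<open>A single-edge move carries its edge as an ordered pair of endpoints; the orientation has no
  effect on the result.\<close>

datatype 'a move =
    Edge_Move 'a 'a real
  | Hypermove "'a set" "'a set set" real

fun is_edge_move :: "'a set set \<Rightarrow> 'a move \<Rightarrow> bool" where
  "is_edge_move E (Edge_Move x y \<mu>) \<longleftrightarrow> {x, y} \<in> E \<and> \<mu> \<in> {0..1/2}"
| "is_edge_move E (Hypermove A F \<mu>) \<longleftrightarrow> False"

fun is_hypermove :: "'a set \<Rightarrow> 'a set set \<Rightarrow> 'a move \<Rightarrow> bool" where
  "is_hypermove V E (Edge_Move x y \<mu>) \<longleftrightarrow> False"
| "is_hypermove V E (Hypermove A F \<mu>) \<longleftrightarrow>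
     A \<subseteq> V \<and> card A \<ge> 3 \<and> F \<subseteq> E \<and> connected_graph A F \<and> \<mu> \<in> {0..1/2}"

fun apply_move :: "'a move \<Rightarrow> ('a \<Rightarrow> real) \<Rightarrow> ('a \<Rightarrow> real)" where
  "apply_move (Edge_Move x y \<mu>) \<eta> =
     \<eta>(x := \<eta> x + \<mu> * (\<eta> y - \<eta> x), y := \<eta> y + \<mu> * (\<eta> x - \<eta> y))"
| "apply_move (Hypermove A F \<mu>) \<eta> =
     (\<lambda>u. if u \<in> A then (1 - 2 * \<mu>) * \<eta> u + 2 * \<mu> * ((\<Sum>w\<in>A. \<eta> w) / real (card A)) else \<eta> u)"

definition apply_moves :: "'a move list \<Rightarrow> ('a \<Rightarrow> real) \<Rightarrow> ('a \<Rightarrow> real)" where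
  "apply_moves ms \<eta> = fold apply_move ms \<eta>"

text \<open>The set below is nonempty (take the empty list) and, for a water profile and a vertex
  \<open>v\<close>, bounded above by the capacity, so \<open>Sup\<close> is a genuine supremum.\<close>

definition \<kappa> :: "'a set set \<Rightarrow> ('a \<Rightarrow> real) \<Rightarrow> 'a \<Rightarrow> real" where
  "\<kappa> E \<eta> v = Sup {apply_moves ms \<eta> v | ms. \<forall>m\<in>set ms. is_edge_move E m}"

end

theory Submission
  imports Defs
begin

text \<open>
  The water level reached at the target is an affine function of the parameter of each single
  move, so every parameter may be taken to be \<open>0\<close> or \<open>1/2\<close>. A move sequence then becomes a word of
  edges, each letter standing for complete averaging over the edge. The supremum is attained because
  the only limits of such words are finite products of averagings over connected vertex sets.

  To see this, consider words over a finite set \<open>F\<close> of edges, by induction on \<open>F\<close>. If \<open>F\<close> falls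
  apart into two parts without common vertices, averagings from different parts commute and a word
  may be sorted into a word over the first part followed by a word over the second. If \<open>F\<close> is
  connected, cut a word into rounds, a round being complete as soon as every edge of \<open>F\<close> has
  occurred in it. Each complete round contracts the squared deviation from the mean over
  \<open>\<Union>F\<close> by a factor that depends on \<open>card (\<Union>F)\<close> only (\<open>energy_contraction\<close>), however
  long the round is: by pigeonhole the values have a gap proportional to their range, and the first
  edge of the round that crosses the gap loses energy accordingly. Hence words with many rounds are
  close to the averaging over \<open>\<Union>F\<close> (\<open>rounds_converge\<close>). A word with boundedly many rounds
  is a concatenation of boundedly many words, each over \<open>F\<close> without some edge, and single letters;
  these are covered by the induction hypothesis.

  Compactness is avoided by phrasing the induction in terms of values: a set of words is dominated
  if, for each nonexpansive functional and each initial profile, a single word of connected sets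
  does at least as well as all its members. Domination passes to concatenations because the best
  value attainable by the second factor is again a nonexpansive functional of the profile
  (\<open>dominated_append\<close>). Applied to evaluation at the target this gives a word of connected
  sets whose value is at least the supremum (\<open>dominated_lists\<close>); since such words are limits
  of edge words (\<open>connected_word_approx\<close>), its value is also at most the supremum.
\<close>

section \<open>Averaging over a set of vertices\<close>

text \<open>Complete averaging over \<open>A\<close>: the hypermove, or for an edge the single-edge move, with
  parameter \<open>1/2\<close>.\<close>

definition avg :: "'a set \<Rightarrow> ('a \<Rightarrow> real) \<Rightarrow> 'a \<Rightarrow> real" where
  "avg A \<eta> = (\<lambda>u. if u \<in> A then (\<Sum>w\<in>A. \<eta> w) / real (card A) else \<eta> u)"

text \<open>A word is a list of vertex sets; its leftmost letter acts first.\<close>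

abbreviation avgs :: "'a set list \<Rightarrow> ('a \<Rightarrow> real) \<Rightarrow> 'a \<Rightarrow> real" where
  "avgs w \<eta> \<equiv> fold avg w \<eta>"

lemma mean_bounds:
  fixes f :: "'a \<Rightarrow> real"
  assumes "finite A" "A \<noteq> {}" "\<And>u. u \<in> A \<Longrightarrow> l \<le> f u" "\<And>u. u \<in> A \<Longrightarrow> f u \<le> h"
  shows "l \<le> (\<Sum>u\<in>A. f u) / real (card A)" "(\<Sum>u\<in>A. f u) / real (card A) \<le> h"
proof -
  have c: "real (card A) > 0"
    using assms(1,2) by (simp add: card_gt_0_iff)
  have "(\<Sum>u\<in>A. f u) \<ge> real (card A) * l" "(\<Sum>u\<in>A. f u) \<le> real (card A) * h"
    using sum_bounded_below[of A l f] sum_bounded_above[of A f h] assms(3,4) by auto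
  then show "l \<le> (\<Sum>u\<in>A. f u) / real (card A)" "(\<Sum>u\<in>A. f u) / real (card A) \<le> h"
    using c by (simp_all add: field_simps)
qed

lemma avg_pair:
  assumes "x \<noteq> y"
  shows "avg {x, y} \<eta> = (\<lambda>u. if u = x \<or> u = y then (\<eta> x + \<eta> y) / 2 else \<eta> u)"
  using assms by (auto simp: avg_def fun_eq_iff)

lemma avg_between:
  assumes "finite e" "u \<in> e" "\<And>w. w \<in> e \<Longrightarrow> l \<le> \<eta> w" "\<And>w. w \<in> e \<Longrightarrow> \<eta> w \<le> h"
  shows "l \<le> avg e \<eta> u" "avg e \<eta> u \<le> h"
  using mean_bounds[of e l \<eta> h] assms by (auto simp: avg_def)

lemma avg_commute:
  assumes "d \<inter> e = {}"
  shows "avg d (avg e \<eta>) = avg e (avg d \<eta>)"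
proof -
  have "(\<Sum>w\<in>d. avg e \<eta> w) = (\<Sum>w\<in>d. \<eta> w)" "(\<Sum>w\<in>e. avg d \<eta> w) = (\<Sum>w\<in>e. \<eta> w)"
    using assms by (auto simp: avg_def intro!: sum.cong)
  then show ?thesis
    using assms by (auto simp: avg_def[of d] avg_def[of e] fun_eq_iff)
qed

lemma avgs_avg_commute:
  assumes "\<And>d. d \<in> set w \<Longrightarrow> d \<inter> e = {}"
  shows "avgs w (avg e \<eta>) = avg e (avgs w \<eta>)"
  using assms
proof (induction w arbitrary: \<eta>)
  case (Cons d w)
  then have "avg d (avg e \<eta>) = avg e (avg d \<eta>)" by (intro avg_commute) simp
  with Cons show ?case by simp
qed simp

text \<open>Letters from two families without common vertices can be sorted by family.\<close>

lemma avgs_split: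
  assumes "set w \<subseteq> F \<union> G" "\<And>d e. d \<in> F \<Longrightarrow> e \<in> G \<Longrightarrow> d \<inter> e = {}"
  shows "\<exists>w1\<in>lists F. \<exists>w2\<in>lists G. \<forall>\<eta>. avgs w \<eta> = avgs (w1 @ w2) \<eta>"
  using assms(1)
proof (induction w)
  case Nil
  show ?case by (intro bexI[of _ "[]"]) auto
next
  case (Cons e w)
  then obtain w1 w2 where w: "w1 \<in> lists F" "w2 \<in> lists G" "\<And>\<eta>. avgs w \<eta> = avgs (w1 @ w2) \<eta>"
    by auto
  show ?case
  proof (cases "e \<in> F")
    case True
    with w show ?thesis by (intro bexI[of _ "e # w1"] bexI[of _ w2]) auto
  next
    case False
    then have e: "e \<in> G" using Cons.prems by auto
    have "avgs w1 (avg e \<eta>) = avg e (avgs w1 \<eta>)" for \<eta>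
      using w(1) e assms(2) by (intro avgs_avg_commute) auto
    with w e show ?thesis by (intro bexI[of _ w1] bexI[of _ "e # w2"]) auto
  qed
qed

section \<open>Words that use every edge of a connected graph\<close>

text \<open>Connectedness of the graph with edge set \<open>F\<close> and vertex set \<open>\<Union>F\<close>, in terms of cuts:
  every vertex set that separates vertices is crossed by an edge.\<close>

definition cut_connected :: "'a set set \<Rightarrow> bool" where
  "cut_connected F \<longleftrightarrow>
     (\<forall>S. \<Union>F \<inter> S \<noteq> {} \<and> \<Union>F - S \<noteq> {} \<longrightarrow> (\<exists>e\<in>F. e \<inter> S \<noteq> {} \<and> e - S \<noteq> {}))"

lemma cut_connected_single: "cut_connected {e}"
  by (auto simp: cut_connected_def)

text \<open>The squared deviation from the level \<open>m\<close>, which is later the mean over \<open>A\<close>.\<close>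

definition energy :: "'a set \<Rightarrow> real \<Rightarrow> ('a \<Rightarrow> real) \<Rightarrow> real" where
  "energy A m \<eta> = (\<Sum>u\<in>A. (\<eta> u - m)\<^sup>2)"

lemma sum_pair_split:
  fixes f :: "'a \<Rightarrow> real"
  assumes "finite A" "x \<in> A" "y \<in> A" "x \<noteq> y"
  shows "(\<Sum>u\<in>A. f u) = f x + f y + (\<Sum>u\<in>A - {x, y}. f u)"
  using assms by (subst sum.subset_diff[of "{x,y}"]) auto

lemma energy_avg_pair:
  assumes "finite A" "x \<in> A" "y \<in> A" "x \<noteq> y"
  shows "energy A m (avg {x, y} \<eta>) = energy A m \<eta> - (\<eta> x - \<eta> y)\<^sup>2 / 2"
proof -
  have "(\<Sum>u\<in>A - {x, y}. (avg {x, y} \<eta> u - m)\<^sup>2) = (\<Sum>u\<in>A - {x, y}. (\<eta> u - m)\<^sup>2)"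
    using assms by (intro sum.cong) (auto simp: avg_pair)
  then show ?thesis
    unfolding energy_def sum_pair_split[OF assms] avg_pair[OF assms(4)]
    by (simp add: power2_eq_square field_simps)
qed

lemma sum_avg:
  assumes "finite A" "e \<subseteq> A"
  shows "(\<Sum>u\<in>A. avg e \<eta> u) = (\<Sum>u\<in>A. \<eta> u)"
proof -
  have "(\<Sum>u\<in>e. avg e \<eta> u) = (\<Sum>u\<in>e. \<eta> u)"
    using finite_subset[OF assms(2,1)] by (cases "e = {}") (auto simp: avg_def)
  moreover have "(\<Sum>u\<in>A - e. avg e \<eta> u) = (\<Sum>u\<in>A - e. \<eta> u)"
    by (intro sum.cong) (auto simp: avg_def)
  ultimately show ?thesis
    using sum.subset_diff[OF assms(2,1), of "avg e \<eta>"] sum.subset_diff[OF assms(2,1), of \<eta>] by simp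
qed

lemma sum_avgs:
  assumes "finite A" "\<And>e. e \<in> set w \<Longrightarrow> e \<subseteq> A"
  shows "(\<Sum>u\<in>A. avgs w \<eta> u) = (\<Sum>u\<in>A. \<eta> u)"
  using assms(2) by (induction w arbitrary: \<eta>) (auto simp: sum_avg[OF assms(1)])

lemma avgs_outside:
  assumes "\<And>e. e \<in> set w \<Longrightarrow> u \<notin> e"
  shows "avgs w \<eta> u = \<eta> u"
  using assms by (induction w arbitrary: \<eta>) (auto simp: avg_def)

lemma energy_avgs_le:
  assumes "finite A" "\<And>e. e \<in> set w \<Longrightarrow> e \<subseteq> A \<and> card e = 2"
  shows "energy A m (avgs w \<eta>) \<le> energy A m \<eta>"
  using assms(2)
proof (induction w arbitrary: \<eta>)
  case (Cons e w)
  obtain x y where e: "e = {x, y}" "x \<noteq> y"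
    using Cons.prems[of e] by (auto simp: card_2_iff)
  have "energy A m (avgs w (avg e \<eta>)) \<le> energy A m (avg e \<eta>)"
    using Cons by auto
  also have "\<dots> = energy A m \<eta> - (\<eta> x - \<eta> y)\<^sup>2 / 2"
    using energy_avg_pair[OF assms(1), of x y m \<eta>] Cons.prems[of e] e by simp
  also have "\<dots> \<le> energy A m \<eta>" by simp
  finally show ?case by simp
qed simp

text \<open>As long as no edge crosses the cut \<open>S\<close>, the values stay on their side of the gap; the first
  crossing edge then averages two values that are at least \<open>h - l\<close> apart. The bound does not depend
  on the length of the word.\<close>

lemma energy_drop_across_gap:
  assumes A: "finite A" and w: "\<And>e. e \<in> set w \<Longrightarrow> e \<subseteq> A \<and> card e = 2"
    and cross: "\<exists>e\<in>set w. e \<inter> S \<noteq> {} \<and> e - S \<noteq> {}"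
    and S: "\<And>u. u \<in> A \<inter> S \<Longrightarrow> h \<le> \<eta> u" "\<And>u. u \<in> A - S \<Longrightarrow> \<eta> u \<le> l" and "l \<le> h"
  shows "energy A m (avgs w \<eta>) \<le> energy A m \<eta> - (h - l)\<^sup>2 / 2"
  using w cross S
proof (induction w arbitrary: \<eta>)
  case Nil
  then show ?case by simp
next
  case (Cons e w)
  obtain x y where e: "e = {x, y}" "x \<noteq> y"
    using Cons.prems(1)[of e] by (auto simp: card_2_iff)
  have xy: "x \<in> A" "y \<in> A" using Cons.prems(1)[of e] e by auto
  have drop: "energy A m (avg e \<eta>) = energy A m \<eta> - (\<eta> x - \<eta> y)\<^sup>2 / 2"
    using energy_avg_pair[OF A xy e(2)] e by simp
  show ?case
  proof (cases "e \<inter> S \<noteq> {} \<and> e - S \<noteq> {}")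
    case True
    then have "(x \<in> S \<and> y \<notin> S) \<or> (y \<in> S \<and> x \<notin> S)" using e by auto
    then have "h - l \<le> \<bar>\<eta> x - \<eta> y\<bar>"
      using Cons.prems(3,4)[of x] Cons.prems(3,4)[of y] xy by auto
    then have "(h - l)\<^sup>2 \<le> (\<eta> x - \<eta> y)\<^sup>2"
      using \<open>l \<le> h\<close> by (metis abs_le_square_iff abs_of_nonneg diff_ge_0_iff_ge)
    moreover have "energy A m (avgs w (avg e \<eta>)) \<le> energy A m (avg e \<eta>)"
      using Cons.prems(1) by (intro energy_avgs_le[OF A]) auto
    ultimately show ?thesis using drop by simp
  next
    case False
    then have side: "e \<subseteq> S \<or> e \<inter> S = {}" by auto
    have fe: "finite e" using e by simp
    have 1: "h \<le> avg e \<eta> u" if "u \<in> A \<inter> S" for u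
    proof (cases "u \<in> e")
      case True
      then have "w \<in> e \<Longrightarrow> h \<le> \<eta> w" for w
        using side that Cons.prems(1)[of e] Cons.prems(3)[of w] by auto
      then show ?thesis
        using avg_between(1)[OF fe True, of h \<eta> "Max (\<eta> ` e)"] fe by auto
    qed (use that Cons.prems(3) in \<open>auto simp: avg_def\<close>)
    have 2: "avg e \<eta> u \<le> l" if "u \<in> A - S" for u
    proof (cases "u \<in> e")
      case True
      then have "w \<in> e \<Longrightarrow> \<eta> w \<le> l" for w
        using side that Cons.prems(1)[of e] Cons.prems(4)[of w] by auto
      then show ?thesis
        using avg_between(2)[OF fe True, of "Min (\<eta> ` e)" \<eta> l] fe by auto
    qed (use that Cons.prems(4) in \<open>auto simp: avg_def\<close>)
    have "energy A m (avgs w (avg e \<eta>)) \<le> energy A m (avg e \<eta>) - (h - l)\<^sup>2 / 2"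
      using Cons.prems(1,2) False 1 2 by (intro Cons.IH) auto
    also have "\<dots> \<le> energy A m \<eta> - (h - l)\<^sup>2 / 2" using drop by simp
    finally show ?thesis by simp
  qed
qed

text \<open>Cut the range of \<open>f\<close> into \<open>card A\<close> intervals of equal length \<open>\<delta>\<close>. With the maximum, which starts
  one more interval, there are \<open>card A + 1\<close> of them, so one contains no value of \<open>f\<close>; it is neither
  the first nor the last.\<close>

lemma ex_gap:
  fixes f :: "'a \<Rightarrow> real"
  assumes A: "finite A" "a \<in> A" "b \<in> A" and ab: "\<And>u. u \<in> A \<Longrightarrow> f a \<le> f u \<and> f u \<le> f b"
    and "f a < f b"
  defines "\<delta> \<equiv> (f b - f a) / real (card A)"
  shows "\<exists>l. (\<forall>u\<in>A. f u < l \<or> l + \<delta> \<le> f u) \<and> f a < l \<and> l + \<delta> \<le> f b"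
proof -
  define n where "n = card A"
  have n: "n > 0" using A by (auto simp: n_def card_gt_0_iff)
  then have \<delta>: "\<delta> > 0" using assms(5) by (simp add: \<delta>_def n_def)
  \<comment> \<open>The index of the interval of length \<open>\<delta>\<close> that contains the value at \<open>u\<close>.\<close>
  define g where "g u = nat \<lfloor>(f u - f a) / \<delta>\<rfloor>" for u
  have "card (g ` A) \<le> n" using A(1) by (simp add: n_def card_image_le)
  then have "\<not> {0..n} \<subseteq> g ` A"
    using card_mono[of "g ` A" "{0..n}"] A(1) by auto
  then obtain k where k: "k \<le> n" "k \<notin> g ` A" by (meson atLeastAtMost_iff subsetI)
  have "g a = 0" by (simp add: g_def)
  moreover have "g b = n"
    using n assms(5) by (simp add: g_def \<delta>_def n_def)
  ultimately have k': "0 < k" "k < n"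
    using k A by (metis gr0I imageI, metis imageI nat_less_le)
  define l where "l = f a + real k * \<delta>"
  have "f u < l \<or> l + \<delta> \<le> f u" if u: "u \<in> A" for u
  proof (rule ccontr)
    assume "\<not> ?thesis"
    then have "real k \<le> (f u - f a) / \<delta>" "(f u - f a) / \<delta> < real k + 1"
      using \<delta> by (auto simp: l_def field_simps)
    then have "\<lfloor>(f u - f a) / \<delta>\<rfloor> = int k" by (simp add: floor_eq_iff)
    then have "g u = k" by (simp add: g_def)
    with k u show False by blast
  qed
  moreover have "f a < l" using k' \<delta> by (simp add: l_def)
  moreover have "l + \<delta> \<le> f b"
  proof -
    have "(real k + 1) * \<delta> \<le> real n * \<delta>" using k' \<delta> by (intro mult_right_mono) auto
    also have "\<dots> = f b - f a" using n by (simp add: \<delta>_def n_def)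
    finally show ?thesis by (simp add: l_def algebra_simps)
  qed
  ultimately show ?thesis by blast
qed

lemma Union_edges_nonempty:
  assumes "\<And>e. e \<in> F \<Longrightarrow> card e = 2" "F \<noteq> {}"
  shows "\<Union>F \<noteq> {}"
proof -
  obtain e where "e \<in> F" using assms(2) by auto
  moreover from this have "e \<noteq> {}" using assms(1)[of e] by auto
  ultimately show ?thesis by auto
qed

text \<open>With \<open>n\<close> vertices and range \<open>D\<close> of the values, the energy is at most \<open>n * D\<^sup>2\<close>, while
  the word loses at least \<open>(D / n)\<^sup>2 / 2\<close> of it across the gap.\<close>

lemma energy_contraction:
  assumes fin: "finite (\<Union>F)" and F: "\<And>e. e \<in> F \<Longrightarrow> card e = 2" "F \<noteq> {}"
    and conn: "cut_connected F" and w: "set w = F"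
    and m: "m = (\<Sum>u\<in>\<Union>F. \<eta> u) / real (card (\<Union>F))"
  shows "energy (\<Union>F) m (avgs w \<eta>) \<le> (1 - 1 / (2 * real (card (\<Union>F)) ^ 3)) * energy (\<Union>F) m \<eta>"
proof -
  define A where "A = \<Union>F"
  have A: "finite A" "A \<noteq> {}" using fin Union_edges_nonempty[OF F] unfolding A_def by blast+
  define n where "n = card A"
  have n: "n > 0" using A by (auto simp: n_def card_gt_0_iff)
  have wA: "\<And>e. e \<in> set w \<Longrightarrow> e \<subseteq> A \<and> card e = 2"
    using w F by (auto simp: A_def)
  obtain a where a: "a \<in> A" "\<And>u. u \<in> A \<Longrightarrow> \<eta> a \<le> \<eta> u"
    using ex_is_arg_min_if_finite[OF A, of \<eta>] by (auto simp: is_arg_min_linorder)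
  obtain b where b: "b \<in> A" "\<And>u. u \<in> A \<Longrightarrow> \<eta> u \<le> \<eta> b"
    using ex_is_arg_min_if_finite[OF A, of "\<lambda>u. - \<eta> u"] by (auto simp: is_arg_min_linorder)
  define D where "D = \<eta> b - \<eta> a"
  have D: "D \<ge> 0" using a b by (simp add: D_def)
  have "\<eta> a \<le> m" "m \<le> \<eta> b"
    using mean_bounds[of A "\<eta> a" \<eta> "\<eta> b"] A a b m by (auto simp: A_def)
  then have "(\<eta> u - m)\<^sup>2 \<le> D\<^sup>2" if "u \<in> A" for u
    using a(2)[OF that] b(2)[OF that] by (intro power2_le_iff_abs_le[THEN iffD2]) (auto simp: D_def)
  then have up: "energy A m \<eta> \<le> real n * D\<^sup>2"
    unfolding energy_def n_def by (intro sum_bounded_above) auto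
  have "energy A m (avgs w \<eta>) \<le> energy A m \<eta> - (D / real n)\<^sup>2 / 2"
  proof (cases "D = 0")
    case True
    then show ?thesis using energy_avgs_le[OF A(1), of w m \<eta>] wA by simp
  next
    case False
    then have "\<eta> a < \<eta> b" using D by (simp add: D_def)
    then obtain l where l: "\<And>u. u \<in> A \<Longrightarrow> \<eta> u < l \<or> l + D / real n \<le> \<eta> u"
        "\<eta> a < l" "l + D / real n \<le> \<eta> b"
      using ex_gap[OF A(1) a(1) b(1), of \<eta>] a(2) b(2) unfolding D_def n_def by blast
    \<comment> \<open>The vertices above the gap; some edge of \<open>F\<close> crosses from there to the rest.\<close>
    define S where "S = {u. l \<le> \<eta> u}"
    have pos: "D / real n \<ge> 0" using D by simp
    have "b \<in> A \<inter> S" "a \<in> A - S" using a b l pos by (auto simp: S_def)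
    then have "\<exists>e\<in>set w. e \<inter> S \<noteq> {} \<and> e - S \<noteq> {}"
      using conn w unfolding cut_connected_def A_def by blast
    moreover have "l + D / real n \<le> \<eta> u" if "u \<in> A \<inter> S" for u
      using that l(1)[of u] by (auto simp: S_def)
    moreover have "\<eta> u \<le> l" if "u \<in> A - S" for u
      using that by (auto simp: S_def)
    ultimately show ?thesis
      using energy_drop_across_gap[of A w S "l + D / real n" \<eta> l m] A(1) wA pos by simp
  qed
  also have "(D / real n)\<^sup>2 / 2 = 1 / (2 * real n ^ 3) * (real n * D\<^sup>2)"
    using n by (simp add: power2_eq_square power3_eq_cube)
  also have "energy A m \<eta> - 1 / (2 * real n ^ 3) * (real n * D\<^sup>2)
      \<le> energy A m \<eta> - 1 / (2 * real n ^ 3) * energy A m \<eta>"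
    using up by (intro diff_left_mono mult_left_mono) auto
  finally show ?thesis by (simp add: A_def n_def algebra_simps)
qed

lemma energy_rounds:
  assumes fin: "finite (\<Union>F)" and F: "\<And>e. e \<in> F \<Longrightarrow> card e = 2" "F \<noteq> {}"
    and conn: "cut_connected F" and ws: "\<forall>w\<in>set ws. set w = F"
    and m: "m = (\<Sum>u\<in>\<Union>F. \<eta> u) / real (card (\<Union>F))"
  shows "energy (\<Union>F) m (avgs (concat ws) \<eta>)
    \<le> (1 - 1 / (2 * real (card (\<Union>F)) ^ 3)) ^ length ws * energy (\<Union>F) m \<eta>"
  using ws m
proof (induction ws arbitrary: \<eta>)
  case (Cons w ws)
  define q where "q = 1 - 1 / (2 * real (card (\<Union>F)) ^ 3)"
  have "card (\<Union>F) > 0" using fin Union_edges_nonempty[OF F] by (meson card_gt_0_iff)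
  then have "real (card (\<Union>F)) ^ 3 \<ge> 1" by (intro one_le_power) auto
  then have "1 / (2 * real (card (\<Union>F)) ^ 3) \<le> 1" by (intro divide_le_eq_1_pos[THEN iffD2]) linarith+
  then have q: "q \<ge> 0" by (simp add: q_def)
  have m': "m = (\<Sum>u\<in>\<Union>F. avgs w \<eta> u) / real (card (\<Union>F))"
    using Cons.prems by (subst sum_avgs[OF fin]) auto
  have "energy (\<Union>F) m (avgs (concat ws) (avgs w \<eta>)) \<le> q ^ length ws * energy (\<Union>F) m (avgs w \<eta>)"
    unfolding q_def using Cons.prems m' by (intro Cons.IH) auto
  also have "\<dots> \<le> q ^ length ws * (q * energy (\<Union>F) m \<eta>)"
  proof (intro mult_left_mono)
    show "energy (\<Union>F) m (avgs w \<eta>) \<le> q * energy (\<Union>F) m \<eta>"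
      unfolding q_def using Cons.prems by (intro energy_contraction[OF fin F conn]) simp_all
    show "q ^ length ws \<ge> 0" using q by simp
  qed
  finally show ?case by (simp add: q_def algebra_simps)
qed simp

lemma rounds_converge:
  assumes fin: "finite (\<Union>F)" and F: "\<And>e. e \<in> F \<Longrightarrow> card e = 2" "F \<noteq> {}"
    and conn: "cut_connected F" and "\<epsilon> > 0"
  shows "\<exists>r. \<forall>ws w u. length ws = r \<and> (\<forall>x\<in>set ws. set x = F) \<and> set w \<subseteq> F \<longrightarrow>
    \<bar>avgs (concat ws @ w) \<eta> u - avg (\<Union>F) \<eta> u\<bar> \<le> \<epsilon>"
proof -
  define A where "A = \<Union>F"
  define m where "m = (\<Sum>u\<in>A. \<eta> u) / real (card A)"
  define q where "q = 1 - 1 / (2 * real (card A) ^ 3)"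
  have "card A > 0" using fin Union_edges_nonempty[OF F] unfolding A_def by (meson card_gt_0_iff)
  then have "real (card A) ^ 3 \<ge> 1" by (intro one_le_power) auto
  then have "1 / (2 * real (card A) ^ 3) \<le> 1" "1 / (2 * real (card A) ^ 3) > 0"
    by (intro divide_le_eq_1_pos[THEN iffD2] divide_pos_pos; linarith)+
  then have q: "0 \<le> q" "q < 1" by (auto simp: q_def)
  have "(\<lambda>r. q ^ r * energy A m \<eta>) \<longlonglongrightarrow> 0"
    using q by (intro tendsto_mult_left_zero LIMSEQ_realpow_zero)
  moreover have "\<epsilon>\<^sup>2 > 0" using \<open>\<epsilon> > 0\<close> by simp
  ultimately have "\<forall>\<^sub>F r in sequentially. q ^ r * energy A m \<eta> < \<epsilon>\<^sup>2"
    by (rule order_tendstoD(2))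
  then obtain r where r: "q ^ r * energy A m \<eta> < \<epsilon>\<^sup>2"
    by (auto simp: eventually_sequentially)
  have "\<bar>avgs (concat ws @ w) \<eta> u - avg A \<eta> u\<bar> \<le> \<epsilon>"
    if ws: "length ws = r" "\<forall>x\<in>set ws. set x = F" and w: "set w \<subseteq> F" for ws w u
  proof (cases "u \<in> A")
    case True
    let ?\<zeta> = "avgs (concat ws @ w) \<eta>"
    have "(?\<zeta> u - m)\<^sup>2 \<le> energy A m ?\<zeta>"
      unfolding energy_def using True fin
      by (intro member_le_sum[of u A "\<lambda>u. (?\<zeta> u - m)\<^sup>2"]) (auto simp: A_def)
    also have "\<dots> \<le> energy A m (avgs (concat ws) \<eta>)"
      using energy_avgs_le[of A w m "avgs (concat ws) \<eta>"] fin w F(1) by (auto simp: A_def)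
    also have "\<dots> \<le> q ^ r * energy A m \<eta>"
      using energy_rounds[OF fin F conn ws(2), of m \<eta>] ws(1) by (simp add: A_def m_def q_def)
    also note r
    finally have "\<bar>?\<zeta> u - m\<bar> \<le> \<epsilon>"
      using \<open>\<epsilon> > 0\<close> by (intro power2_le_iff_abs_le[THEN iffD1]) auto
    then show ?thesis using True by (simp add: avg_def m_def)
  next
    case False
    have "e \<in> F" if "e \<in> set (concat ws @ w)" for e
      using that ws(2) w by (auto split: if_splits)
    with False have "avgs (concat ws @ w) \<eta> u = \<eta> u"
      by (intro avgs_outside) (auto simp: A_def)
    with False \<open>\<epsilon> > 0\<close> show ?thesis by (simp add: avg_def)
  qed
  then show ?thesis unfolding A_def by blast
qed

text \<open>The letter that completes the first round does not occur earlier in it.\<close>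

lemma first_full_prefix:
  assumes "set w = F" "F \<noteq> {}"
  shows "\<exists>u e w'. w = u @ e # w' \<and> e \<notin> set u \<and> set (u @ [e]) = F"
  using assms(1)
proof (induction w rule: rev_induct)
  case Nil
  with assms(2) show ?case by simp
next
  case (snoc x w)
  show ?case
  proof (cases "set w = F")
    case True
    then obtain u e w' where "w = u @ e # w'" "e \<notin> set u" "set (u @ [e]) = F"
      using snoc.IH by blast
    then show ?thesis by (intro exI[of _ u] exI[of _ e] exI[of _ "w' @ [x]"]) auto
  next
    case False
    with snoc.prems show ?thesis by (intro exI[of _ w] exI[of _ x] exI[of _ "[]"]) auto
  qed
qed

section \<open>Dominating edge words by words of connected sets\<close>

text \<open>Functionals that are 1-Lipschitz for the maximum norm on \<open>V\<close>; in particular they ignore the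
  values outside \<open>V\<close>.\<close>

definition nonexpansive :: "'a set \<Rightarrow> (('a \<Rightarrow> real) \<Rightarrow> real) \<Rightarrow> bool" where
  "nonexpansive V \<phi> \<longleftrightarrow> (\<forall>\<eta> \<zeta> d. (\<forall>u\<in>V. \<bar>\<eta> u - \<zeta> u\<bar> \<le> d) \<longrightarrow> \<phi> \<eta> \<le> \<phi> \<zeta> + d)"

lemma nonexpansiveD:
  "nonexpansive V \<phi> \<Longrightarrow> (\<And>u. u \<in> V \<Longrightarrow> \<bar>\<eta> u - \<zeta> u\<bar> \<le> d) \<Longrightarrow> \<phi> \<eta> \<le> \<phi> \<zeta> + d"
  by (auto simp: nonexpansive_def)

locale finite_simple_graph =
  fixes V :: "'a set" and E :: "'a set set"
  assumes finite_V: "finite V" and simple: "simple_graph V E"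
begin

lemma edge: "e \<in> E \<Longrightarrow> e \<subseteq> V" "e \<in> E \<Longrightarrow> card e = 2"
  using simple by (auto simp: simple_graph_def)

lemma finite_E: "finite E"
  using finite_V edge(1) by (intro finite_subset[of E "Pow V"]) auto

lemma avg_dist:
  assumes "e \<subseteq> V" "\<And>u. u \<in> V \<Longrightarrow> \<bar>\<eta> u - \<zeta> u\<bar> \<le> d" "u \<in> V"
  shows "\<bar>avg e \<eta> u - avg e \<zeta> u\<bar> \<le> d"
proof (cases "u \<in> e")
  case True
  have "avg e \<eta> u - avg e \<zeta> u = (\<Sum>w\<in>e. \<eta> w - \<zeta> w) / real (card e)"
    using True by (simp add: avg_def sum_subtractf diff_divide_distrib)
  moreover have "- d \<le> \<eta> w - \<zeta> w" "\<eta> w - \<zeta> w \<le> d" if "w \<in> e" for w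
    using assms(2)[of w] subsetD[OF assms(1) that] by (auto simp: abs_le_iff)
  ultimately show ?thesis
    using mean_bounds[of e "- d" "\<lambda>w. \<eta> w - \<zeta> w" d] True finite_subset[OF assms(1) finite_V]
    by (intro abs_leI) fastforce+
qed (use assms in \<open>auto simp: avg_def\<close>)

lemma avgs_dist:
  assumes "w \<in> lists (Pow V)" "\<And>u. u \<in> V \<Longrightarrow> \<bar>\<eta> u - \<zeta> u\<bar> \<le> d" "u \<in> V"
  shows "\<bar>avgs w \<eta> u - avgs w \<zeta> u\<bar> \<le> d"
  using assms
proof (induction w arbitrary: \<eta> \<zeta> rule: list.induct)
  case (Cons e w)
  have "\<bar>avg e \<eta> u - avg e \<zeta> u\<bar> \<le> d" if "u \<in> V" for u
    using Cons.prems that by (intro avg_dist[of e]) auto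
  then show ?case using Cons by simp
qed simp

lemma avgs_change_bounded: "\<exists>B. \<forall>w\<in>lists (Pow V). \<forall>u\<in>V. \<bar>avgs w \<eta> u - \<eta> u\<bar> \<le> B"
proof -
  define B where "B = (\<Sum>u\<in>V. \<bar>\<eta> u\<bar>)"
  have B: "\<bar>\<eta> u\<bar> \<le> B" if "u \<in> V" for u
    unfolding B_def using that finite_V by (intro member_le_sum) auto
  have "\<bar>avgs w \<eta> u\<bar> \<le> B" if "w \<in> lists (Pow V)" "u \<in> V" for w u
  proof -
    have "avg e (\<lambda>_. 0) = (\<lambda>_. 0)" for e :: "'a set" by (simp add: avg_def fun_eq_iff)
    then have "avgs w (\<lambda>_. 0) = (\<lambda>_. 0)" by (induction w) simp_all
    then show ?thesis using avgs_dist[OF that(1), of \<eta> "\<lambda>_. 0" B u] B that(2) by simp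
  qed
  with B show ?thesis by (intro exI[of _ "2 * B"]) force
qed

text \<open>The best value of \<open>\<phi>\<close> that words from \<open>W\<close> can reach. This is a genuine supremum for nonempty
  \<open>W \<subseteq> lists (Pow V)\<close> and nonexpansive \<open>\<phi>\<close>, as a profile changes only by a bounded amount.\<close>

definition best :: "(('a \<Rightarrow> real) \<Rightarrow> real) \<Rightarrow> 'a set list set \<Rightarrow> ('a \<Rightarrow> real) \<Rightarrow> real" where
  "best \<phi> W \<eta> = (SUP w\<in>W. \<phi> (avgs w \<eta>))"

lemma best_upper:
  assumes "nonexpansive V \<phi>" "W \<subseteq> lists (Pow V)" "w \<in> W"
  shows "\<phi> (avgs w \<eta>) \<le> best \<phi> W \<eta>"
proof -
  obtain B where B: "\<forall>w\<in>lists (Pow V). \<forall>u\<in>V. \<bar>avgs w \<eta> u - \<eta> u\<bar> \<le> B"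
    using avgs_change_bounded by blast
  have "\<phi> (avgs w \<eta>) \<le> \<phi> \<eta> + B" if "w \<in> W" for w
    using nonexpansiveD[OF assms(1), of "avgs w \<eta>" \<eta> B] assms(2) B that by blast
  then have "bdd_above ((\<lambda>w. \<phi> (avgs w \<eta>)) ` W)" by (intro bdd_aboveI2)
  then show ?thesis unfolding best_def using assms(3) by (rule cSUP_upper2) simp
qed

lemma nonexpansive_best:
  assumes \<phi>: "nonexpansive V \<phi>" and W: "W \<subseteq> lists (Pow V)" "W \<noteq> {}"
  shows "nonexpansive V (best \<phi> W)"
  unfolding nonexpansive_def
proof (intro allI impI)
  fix \<eta> \<zeta> :: "'a \<Rightarrow> real" and d assume d: "\<forall>u\<in>V. \<bar>\<eta> u - \<zeta> u\<bar> \<le> d"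
  have "\<phi> (avgs w \<eta>) \<le> best \<phi> W \<zeta> + d" if w: "w \<in> W" for w
  proof -
    have "\<phi> (avgs w \<eta>) \<le> \<phi> (avgs w \<zeta>) + d"
      using w W(1) d by (intro nonexpansiveD[OF \<phi>] avgs_dist) auto
    with best_upper[OF \<phi> W(1) w, of \<zeta>] show ?thesis by simp
  qed
  then show "best \<phi> W \<eta> \<le> best \<phi> W \<zeta> + d"
    unfolding best_def[of \<phi> W \<eta>] using W(2) by (intro cSUP_least)
qed

text \<open>The vertex sets of the connected subgraphs with at least one edge, which are the sets over
  which a single-edge move or a hypermove can average.\<close>

definition connected_sets :: "'a set set" where
  "connected_sets = {\<Union>F | F. F \<subseteq> E \<and> F \<noteq> {} \<and> cut_connected F}"

lemma edges_connected_sets: "E \<subseteq> connected_sets"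
proof
  fix e assume "e \<in> E"
  then show "e \<in> connected_sets"
    unfolding connected_sets_def using cut_connected_single[of e]
    by (intro CollectI exI[of _ "{e}"]) auto
qed

text \<open>For each functional and each profile, some word of connected sets does at least as well as all
  words from \<open>W\<close>. The word may depend on the functional and the profile, but not on the member of
  \<open>W\<close>.\<close>

definition dominated :: "'a set list set \<Rightarrow> bool" where
  "dominated W \<longleftrightarrow> (\<forall>\<phi> \<eta>. nonexpansive V \<phi> \<longrightarrow>
     (\<exists>h\<in>lists connected_sets. \<forall>w\<in>W. \<phi> (avgs w \<eta>) \<le> \<phi> (avgs h \<eta>)))"

lemma dominatedE:
  assumes "dominated W" "nonexpansive V \<phi>"
  obtains h where "h \<in> lists connected_sets" "\<And>w. w \<in> W \<Longrightarrow> \<phi> (avgs w \<eta>) \<le> \<phi> (avgs h \<eta>)"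
  using assms unfolding dominated_def by blast

lemma dominated_mono: "dominated W \<Longrightarrow> W' \<subseteq> W \<Longrightarrow> dominated W'"
  unfolding dominated_def by blast

lemma dominated_empty: "dominated {}"
  unfolding dominated_def by auto

lemma dominated_single: "w \<in> lists connected_sets \<Longrightarrow> dominated {w}"
  unfolding dominated_def by blast

lemma dominated_Un:
  assumes "dominated W" "dominated W'"
  shows "dominated (W \<union> W')"
  unfolding dominated_def
proof (intro allI impI)
  fix \<phi> :: "('a \<Rightarrow> real) \<Rightarrow> real" and \<eta> assume \<phi>: "nonexpansive V \<phi>"
  obtain h where h: "h \<in> lists connected_sets" "\<And>w. w \<in> W \<Longrightarrow> \<phi> (avgs w \<eta>) \<le> \<phi> (avgs h \<eta>)"
    using dominatedE[OF assms(1) \<phi>] by blast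
  obtain h' where h': "h' \<in> lists connected_sets" "\<And>w. w \<in> W' \<Longrightarrow> \<phi> (avgs w \<eta>) \<le> \<phi> (avgs h' \<eta>)"
    using dominatedE[OF assms(2) \<phi>] by blast
  show "\<exists>h\<in>lists connected_sets. \<forall>w\<in>W \<union> W'. \<phi> (avgs w \<eta>) \<le> \<phi> (avgs h \<eta>)"
  proof (cases "\<phi> (avgs h \<eta>) \<le> \<phi> (avgs h' \<eta>)")
    case True
    then show ?thesis using h h' by (intro bexI[of _ h']) force+
  next
    case False
    then show ?thesis using h h' by (intro bexI[of _ h]) force+
  qed
qed

lemma dominated_UN:
  assumes "finite I" "\<And>i. i \<in> I \<Longrightarrow> dominated (W i)"
  shows "dominated (\<Union>i\<in>I. W i)"
  using assms by (induction rule: finite_induct) (auto intro: dominated_Un dominated_empty)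

text \<open>The first factor is optimised for the best value of the second, and the second factor is then
  optimised for the profile that the first one produces.\<close>

lemma dominated_append:
  assumes W: "dominated W" and W': "dominated W'" "W' \<subseteq> lists (Pow V)"
  shows "dominated {w @ w' | w w'. w \<in> W \<and> w' \<in> W'}"
proof (cases "W' = {}")
  case True
  then show ?thesis by (simp add: dominated_empty)
next
  case False
  show ?thesis
    unfolding dominated_def
  proof (intro allI impI)
    fix \<phi> :: "('a \<Rightarrow> real) \<Rightarrow> real" and \<eta> assume \<phi>: "nonexpansive V \<phi>"
    obtain h where h: "h \<in> lists connected_sets"
        "\<And>w. w \<in> W \<Longrightarrow> best \<phi> W' (avgs w \<eta>) \<le> best \<phi> W' (avgs h \<eta>)"
      using dominatedE[OF W nonexpansive_best[OF \<phi> W'(2) False], of \<eta>] by blast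
    obtain h' where h': "h' \<in> lists connected_sets"
        "\<And>w. w \<in> W' \<Longrightarrow> \<phi> (avgs w (avgs h \<eta>)) \<le> \<phi> (avgs h' (avgs h \<eta>))"
      using dominatedE[OF W'(1) \<phi>, of "avgs h \<eta>"] by blast
    have "\<phi> (avgs (w @ w') \<eta>) \<le> \<phi> (avgs (h @ h') \<eta>)" if "w \<in> W" "w' \<in> W'" for w w'
    proof -
      have "\<phi> (avgs w' (avgs w \<eta>)) \<le> best \<phi> W' (avgs w \<eta>)"
        using best_upper[OF \<phi> W'(2) that(2)] .
      also have "\<dots> \<le> best \<phi> W' (avgs h \<eta>)" using h(2)[OF that(1)] .
      also have "\<dots> \<le> \<phi> (avgs h' (avgs h \<eta>))"
        unfolding best_def using False h'(2) by (intro cSUP_least)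
      finally show ?thesis by simp
    qed
    then show "\<exists>h\<in>lists connected_sets.
        \<forall>w\<in>{w @ w' | w w'. w \<in> W \<and> w' \<in> W'}. \<phi> (avgs w \<eta>) \<le> \<phi> (avgs h \<eta>)"
      using h(1) h'(1) by (intro bexI[of _ "h @ h'"]) auto
  qed
qed

text \<open>The words over \<open>F\<close> that do not start with \<open>r\<close> complete rounds, that is, with \<open>r\<close> consecutive
  blocks each of which uses every edge of \<open>F\<close>.\<close>

definition few_rounds :: "'a set set \<Rightarrow> nat \<Rightarrow> 'a set list set" where
  "few_rounds F r = {w \<in> lists F.
     \<not> (\<exists>ws w'. w = concat ws @ w' \<and> length ws = r \<and> (\<forall>x\<in>set ws. set x = F))}"

text \<open>A word without a complete first round misses some edge. Otherwise the first round ends with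
  an edge \<open>e\<close> that it did not use before, and fewer than \<open>r\<close> rounds follow.\<close>

lemma few_rounds_Suc:
  assumes "F \<noteq> {}"
  shows "few_rounds F (Suc r) \<subseteq> (\<Union>e\<in>F. lists (F - {e})) \<union>
    (\<Union>e\<in>F. {u @ w | u w. u \<in> lists (F - {e}) \<and> w \<in> {[e] @ w' | w'. w' \<in> few_rounds F r}})"
proof
  fix w assume w: "w \<in> few_rounds F (Suc r)"
  then have wF: "set w \<subseteq> F" by (auto simp: few_rounds_def)
  show "w \<in> (\<Union>e\<in>F. lists (F - {e})) \<union>
    (\<Union>e\<in>F. {u @ w | u w. u \<in> lists (F - {e}) \<and> w \<in> {[e] @ w' | w'. w' \<in> few_rounds F r}})"
  proof (cases "set w = F")
    case True
    then obtain u e w' where u: "w = u @ e # w'" "e \<notin> set u" "set (u @ [e]) = F"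
      using first_full_prefix[OF True assms] by blast
    have "w' \<in> few_rounds F r"
    proof (rule ccontr)
      assume "w' \<notin> few_rounds F r"
      moreover have "w' \<in> lists F" using wF u by auto
      ultimately obtain ws w'' where
        ws: "w' = concat ws @ w''" "length ws = r" "\<forall>x\<in>set ws. set x = F"
        by (auto simp: few_rounds_def)
      have "w = concat ((u @ [e]) # ws) @ w''" "length ((u @ [e]) # ws) = Suc r"
        "\<forall>x\<in>set ((u @ [e]) # ws). set x = F"
        using u ws by auto
      with w show False unfolding few_rounds_def by blast
    qed
    moreover have "u \<in> lists (F - {e})" "e \<in> F" using u by auto
    moreover have "w = u @ ([e] @ w')" using u(1) by simp
    ultimately show ?thesis by blast
  next
    case False
    with wF obtain e where "e \<in> F" "e \<notin> set w" by auto
    with wF show ?thesis by auto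
  qed
qed

lemma dominated_few_rounds:
  assumes F: "F \<subseteq> E" "F \<noteq> {}" and less: "\<And>e. e \<in> F \<Longrightarrow> dominated (lists (F - {e}))"
  shows "dominated (few_rounds F r)"
proof (induction r)
  case 0
  have "few_rounds F 0 = {}" by (auto simp: few_rounds_def)
  then show ?case by (simp add: dominated_empty)
next
  case (Suc r)
  have fin: "finite F" using F finite_E finite_subset by blast
  have sub: "few_rounds F r \<subseteq> lists (Pow V)" 
  proof -
    have "F \<subseteq> Pow V" using F(1) edge(1) by auto
    then have "lists F \<subseteq> lists (Pow V)" by (rule lists_mono)
    then show ?thesis unfolding few_rounds_def by blast
  qed
  have "dominated {u @ w | u w. u \<in> lists (F - {e}) \<and> w \<in> {[e] @ w' | w'. w' \<in> few_rounds F r}}"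
    if e: "e \<in> F" for e
  proof (intro dominated_append less e)
    have "dominated {[e]}"
      using e F edges_connected_sets by (intro dominated_single) auto
    from dominated_append[OF this Suc sub]
    show "dominated {[e] @ w' | w'. w' \<in> few_rounds F r}" by simp
    show "{[e] @ w' | w'. w' \<in> few_rounds F r} \<subseteq> lists (Pow V)"
    proof -
      have "e \<in> Pow V" using e F(1) edge(1) by auto
      then have "[e] @ w' \<in> lists (Pow V)" if "w' \<in> few_rounds F r" for w'
        using subsetD[OF sub that] by simp
      then show ?thesis by blast
    qed
  qed
  note * = dominated_UN[OF fin this]
  have "dominated (\<Union>e\<in>F. lists (F - {e}))" by (intro dominated_UN fin less)
  from dominated_mono[OF dominated_Un[OF this *] few_rounds_Suc[OF F(2)]] show ?case .
qed

text \<open>Either averaging over \<open>\<Union>F\<close> is at least as good as every word, or some word \<open>w0\<close> is strictly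
  better; then words with sufficiently many rounds are no better than \<open>w0\<close>, and only words with few
  rounds remain to be compared.\<close>

lemma dominated_lists_connected:
  assumes F: "F \<subseteq> E" "F \<noteq> {}" and less: "\<And>e. e \<in> F \<Longrightarrow> dominated (lists (F - {e}))"
    and conn: "cut_connected F"
  shows "dominated (lists F)"
  unfolding dominated_def
proof (intro allI impI)
  fix \<phi> :: "('a \<Rightarrow> real) \<Rightarrow> real" and \<eta> assume \<phi>: "nonexpansive V \<phi>"
  have A: "\<Union>F \<in> connected_sets" using F conn by (auto simp: connected_sets_def)
  have fin: "finite (\<Union>F)" using F edge(1) finite_V by (meson Union_least finite_subset subset_iff)
  show "\<exists>h\<in>lists connected_sets. \<forall>w\<in>lists F. \<phi> (avgs w \<eta>) \<le> \<phi> (avgs h \<eta>)"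
  proof (cases "\<forall>w\<in>lists F. \<phi> (avgs w \<eta>) \<le> \<phi> (avg (\<Union>F) \<eta>)")
    case True
    then show ?thesis using A by (intro bexI[of _ "[\<Union>F]"]) auto
  next
    case False
    then obtain w0 where w0: "w0 \<in> lists F" "\<phi> (avgs w0 \<eta>) > \<phi> (avg (\<Union>F) \<eta>)"
      by (meson not_le)
    \<comment> \<open>The advantage of \<open>w0\<close> is the accuracy required of words with many rounds.\<close>
    define \<epsilon> where "\<epsilon> = \<phi> (avgs w0 \<eta>) - \<phi> (avg (\<Union>F) \<eta>)"
    have "\<epsilon> > 0" using w0 by (simp add: \<epsilon>_def)
    then obtain r where r: "\<And>ws w u. length ws = r \<Longrightarrow> \<forall>x\<in>set ws. set x = F \<Longrightarrow> set w \<subseteq> F \<Longrightarrow>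
        \<bar>avgs (concat ws @ w) \<eta> u - avg (\<Union>F) \<eta> u\<bar> \<le> \<epsilon>"
      using rounds_converge[OF fin _ F(2) conn, of \<epsilon> \<eta>] F(1) edge(2) by blast
    have "w0 \<in> lists connected_sets" using w0 F edges_connected_sets by auto
    then have dom: "dominated (few_rounds F r \<union> {w0})"
      by (intro dominated_Un dominated_few_rounds[OF F less] dominated_single)
    then obtain h where h: "h \<in> lists connected_sets"
        "\<And>w. w \<in> few_rounds F r \<union> {w0} \<Longrightarrow> \<phi> (avgs w \<eta>) \<le> \<phi> (avgs h \<eta>)"
      using dominatedE[OF dom \<phi>, of \<eta>] by blast
    have "\<phi> (avgs w \<eta>) \<le> \<phi> (avgs h \<eta>)" if w: "w \<in> lists F" for w
    proof (cases "w \<in> few_rounds F r")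
      case True
      then show ?thesis using h by auto
    next
      case False
      then obtain ws w' where ws: "w = concat ws @ w'" "length ws = r" "\<forall>x\<in>set ws. set x = F"
        using w by (auto simp: few_rounds_def)
      have "set w' \<subseteq> F" using w ws(1) by auto
      then have "\<phi> (avgs w \<eta>) \<le> \<phi> (avg (\<Union>F) \<eta>) + \<epsilon>"
        unfolding ws(1) by (intro nonexpansiveD[OF \<phi>] r ws)
      also have "\<dots> = \<phi> (avgs w0 \<eta>)" by (simp add: \<epsilon>_def)
      also have "\<dots> \<le> \<phi> (avgs h \<eta>)" using h(2) by auto
      finally show ?thesis .
    qed
    with h(1) show ?thesis by blast
  qed
qed

lemma dominated_lists:
  assumes "F \<subseteq> E"
  shows "dominated (lists F)"
proof -
  have "finite F" using assms finite_E finite_subset by blast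
  then show ?thesis using assms
  proof (induction F rule: finite_psubset_induct)
    case (psubset F)
    show ?case
    proof (cases "F = {}")
      case True
      then show ?thesis by (simp add: dominated_single)
    next
      case nonempty: False
      show ?thesis
      proof (cases "cut_connected F")
        case True
        have "dominated (lists (F - {e}))" if "e \<in> F" for e
          using that psubset.prems by (intro psubset.IH) auto
        then show ?thesis using dominated_lists_connected[OF psubset.prems nonempty] True by blast
      next
        case False
        \<comment> \<open>A cut that no edge crosses splits \<open>F\<close> into two smaller sets of edges.\<close>
        then obtain S where S: "\<Union>F \<inter> S \<noteq> {}" "\<Union>F - S \<noteq> {}" "\<And>e. e \<in> F \<Longrightarrow> e \<subseteq> S \<or> e \<inter> S = {}"
          unfolding cut_connected_def by blast
        define F1 where "F1 = {e \<in> F. e \<subseteq> S}"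
        define F2 where "F2 = {e \<in> F. e \<inter> S = {}}"
        have "F1 \<subset> F" "F2 \<subset> F" using S unfolding F1_def F2_def by blast+
        then have dom: "dominated (lists F1)" "dominated (lists F2)"
          using psubset by auto
        have sub: "lists F2 \<subseteq> lists (Pow V)"
          using psubset.prems edge(1) by (intro lists_mono) (auto simp: F2_def)
        note dom12 = dominated_append[OF dom sub]
        have "F \<subseteq> F1 \<union> F2" using S(3) by (auto simp: F1_def F2_def)
        then have eq: "\<exists>w'\<in>{u @ v | u v. u \<in> lists F1 \<and> v \<in> lists F2}. \<forall>\<eta>. avgs w \<eta> = avgs w' \<eta>"
          if "w \<in> lists F" for w
        proof -
          have "\<exists>w1\<in>lists F1. \<exists>w2\<in>lists F2. \<forall>\<eta>. avgs w \<eta> = avgs (w1 @ w2) \<eta>"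
            using that \<open>F \<subseteq> F1 \<union> F2\<close> by (intro avgs_split) (auto simp: F1_def F2_def)
          then show ?thesis by blast
        qed
        show ?thesis
          unfolding dominated_def
        proof (intro allI impI)
          fix \<phi> :: "('a \<Rightarrow> real) \<Rightarrow> real" and \<eta> assume "nonexpansive V \<phi>"
          then obtain h where h: "h \<in> lists connected_sets"
            "\<And>w. w \<in> {u @ v | u v. u \<in> lists F1 \<and> v \<in> lists F2} \<Longrightarrow> \<phi> (avgs w \<eta>) \<le> \<phi> (avgs h \<eta>)"
            using dominatedE[OF dom12, of \<phi> \<eta>] by blast
          have "\<phi> (avgs w \<eta>) \<le> \<phi> (avgs h \<eta>)" if w: "w \<in> lists F" for w
          proof -
            obtain w' where w': "w' \<in> {u @ v | u v. u \<in> lists F1 \<and> v \<in> lists F2}"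
                "\<forall>\<eta>. avgs w \<eta> = avgs w' \<eta>"
              using eq[OF w] by blast
            show ?thesis using h(2)[OF w'(1)] w'(2) by simp
          qed
          with h(1) show "\<exists>h\<in>lists connected_sets. \<forall>w\<in>lists F. \<phi> (avgs w \<eta>) \<le> \<phi> (avgs h \<eta>)"
            by blast
        qed
      qed
    qed
  qed
qed

section \<open>Translation to water moves\<close>

lemma connected_sets_subset: "A \<in> connected_sets \<Longrightarrow> A \<subseteq> V"
  using edge(1) by (auto simp: connected_sets_def)

text \<open>Averaging over the vertex set of a connected graph is a limit of edge words, namely of
  repetitions of a word that uses all of its edges.\<close>

lemma connected_word_approx:
  assumes "h \<in> lists connected_sets" "\<epsilon> > 0"
  shows "\<exists>w\<in>lists E. \<forall>u\<in>V. \<bar>avgs h \<eta> u - avgs w \<eta> u\<bar> \<le> \<epsilon>"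
  using assms
proof (induction h arbitrary: \<eta> \<epsilon> rule: list.induct)
  case Nil
  then show ?case by (intro bexI[of _ "[]"]) auto
next
  case (Cons A h)
  obtain F where F: "A = \<Union>F" "F \<subseteq> E" "F \<noteq> {}" "cut_connected F"
    using Cons.prems by (auto simp: connected_sets_def)
  have fin: "finite (\<Union>F)" using F edge(1) finite_V by (meson Union_least finite_subset subset_iff)
  have h: "h \<in> lists connected_sets" "\<epsilon> / 2 > 0" using Cons.prems by auto
  obtain r where r: "\<And>ws w u. length ws = r \<Longrightarrow> \<forall>x\<in>set ws. set x = F \<Longrightarrow> set w \<subseteq> F \<Longrightarrow>
        \<bar>avgs (concat ws @ w) \<eta> u - avg (\<Union>F) \<eta> u\<bar> \<le> \<epsilon> / 2"
      using rounds_converge[OF fin _ F(3,4) h(2), of \<eta>] F(2) edge(2) by blast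
  obtain x where x: "set x = F" using finite_list F(2) finite_E finite_subset by metis
  define w1 where "w1 = concat (replicate r x)"
  have w1: "w1 \<in> lists E" using x F(2) by (auto simp: w1_def)
  have d1: "\<bar>avg A \<eta> u - avgs w1 \<eta> u\<bar> \<le> \<epsilon> / 2" for u
    using r[of "replicate r x" "[]" u] x F(1) by (auto simp: w1_def abs_minus_commute)
  obtain w2 where w2: "w2 \<in> lists E" "\<And>u. u \<in> V \<Longrightarrow> \<bar>avgs h (avgs w1 \<eta>) u - avgs w2 (avgs w1 \<eta>) u\<bar> \<le> \<epsilon> / 2"
    using Cons.IH[OF h, of "avgs w1 \<eta>"] by blast
  have "\<bar>avgs h (avg A \<eta>) u - avgs w2 (avgs w1 \<eta>) u\<bar> \<le> \<epsilon>" if u: "u \<in> V" for u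
  proof -
    have "\<bar>avgs h (avg A \<eta>) u - avgs h (avgs w1 \<eta>) u\<bar> \<le> \<epsilon> / 2"
      using h(1) connected_sets_subset by (intro avgs_dist d1 u) auto
    with w2(2)[OF u] show ?thesis by linarith
  qed
  with w1 w2(1) show ?case by (intro bexI[of _ "w1 @ w2"]) auto
qed

lemma cut_connected_imp_connected_graph:
  assumes F: "F \<subseteq> E" "F \<noteq> {}" "cut_connected F"
  shows "connected_graph (\<Union>F) F"
  unfolding connected_graph_def
proof (intro conjI ballI)
  show "simple_graph (\<Union>F) F" using F(1) edge(2) by (auto simp: simple_graph_def)
  show "\<Union>F \<noteq> {}" using F edge(2) by fastforce
  fix u w assume u: "u \<in> \<Union>F" and w: "w \<in> \<Union>F"
  let ?R = "{(x, y). {x, y} \<in> F}"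
  \<comment> \<open>The set of vertices reachable from \<open>u\<close> is crossed by no edge.\<close>
  define S where "S = {y. (u, y) \<in> ?R\<^sup>*}"
  show "(u, w) \<in> ?R\<^sup>*"
  proof (rule ccontr)
    assume "(u, w) \<notin> ?R\<^sup>*"
    then have "w \<notin> S" "u \<in> S" by (auto simp: S_def)
    then obtain e where e: "e \<in> F" "e \<inter> S \<noteq> {}" "e - S \<noteq> {}"
      using F(3) u w unfolding cut_connected_def by blast
    then obtain x y where xy: "x \<in> e" "x \<in> S" "y \<in> e" "y \<notin> S" by blast
    moreover have "card e = 2" using e(1) F(1) edge(2) by auto
    ultimately have "e = {x, y}" by (auto simp: card_2_iff)
    then have "(x, y) \<in> ?R" using e(1) by simp
    with xy(2,4) show False by (auto simp: S_def intro: rtrancl_into_rtrancl)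
  qed
qed

lemma connected_set_move:
  assumes "A \<in> connected_sets"
  shows "\<exists>m. (is_edge_move E m \<or> is_hypermove V E m) \<and> apply_move m = avg A"
proof -
  obtain F where F: "A = \<Union>F" "F \<subseteq> E" "F \<noteq> {}" "cut_connected F"
    using assms by (auto simp: connected_sets_def)
  obtain e where e: "e \<in> F" using F by auto
  have finA: "finite A" using finite_subset[OF connected_sets_subset[OF assms] finite_V] .
  show ?thesis
  proof (cases "card A \<ge> 3")
    case True
    have "apply_move (Hypermove A F (1/2)) = avg A" by (auto simp: avg_def fun_eq_iff)
    moreover have "is_hypermove V E (Hypermove A F (1/2))"
      using True F cut_connected_imp_connected_graph[of F] connected_sets_subset[OF assms] by auto
    ultimately show ?thesis by blast
  next
    case False
    have "e \<subseteq> A" "card e = 2" using e F edge(2) by auto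
    then have "A = e" using False card_seteq[OF finA, of e] by auto
    then obtain x y where xy: "A = {x, y}" "x \<noteq> y" using \<open>card e = 2\<close> by (auto simp: card_2_iff)
    have "apply_move (Edge_Move x y (1/2)) = avg A"
      using xy by (auto simp: avg_pair fun_eq_iff field_simps)
    moreover have "is_edge_move E (Edge_Move x y (1/2))" using xy \<open>A = e\<close> e F by auto
    ultimately show ?thesis by blast
  qed
qed

lemma connected_word_moves:
  assumes "h \<in> lists connected_sets"
  shows "\<exists>ms. (\<forall>m\<in>set ms. is_edge_move E m \<or> is_hypermove V E m) \<and> (\<forall>\<eta>. apply_moves ms \<eta> = avgs h \<eta>)"
  using assms
proof (induction h rule: list.induct)
  case Nil
  show ?case by (intro exI[of _ "[]"]) (auto simp: apply_moves_def)
next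
  case (Cons A h)
  then obtain ms where "\<forall>m\<in>set ms. is_edge_move E m \<or> is_hypermove V E m"
      "\<forall>\<eta>. apply_moves ms \<eta> = avgs h \<eta>" by auto
  moreover obtain m where "is_edge_move E m \<or> is_hypermove V E m" "apply_move m = avg A"
    using connected_set_move[of A] Cons.prems by auto
  ultimately show ?case by (intro exI[of _ "m # ms"]) (auto simp: apply_moves_def)
qed

lemma edge_word_moves:
  assumes "w \<in> lists E"
  shows "\<exists>ms. (\<forall>m\<in>set ms. is_edge_move E m) \<and> (\<forall>\<eta>. apply_moves ms \<eta> = avgs w \<eta>)"
  using assms
proof (induction w rule: list.induct)
  case Nil
  show ?case by (intro exI[of _ "[]"]) (auto simp: apply_moves_def)
next
  case (Cons e w)
  then obtain ms where "\<forall>m\<in>set ms. is_edge_move E m" "\<forall>\<eta>. apply_moves ms \<eta> = avgs w \<eta>" by auto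
  moreover obtain x y where "e = {x, y}" "x \<noteq> y"
    using Cons.prems edge(2)[of e] by (auto simp: card_2_iff)
  then have "apply_move (Edge_Move x y (1/2)) = avg e" "is_edge_move E (Edge_Move x y (1/2))"
    using Cons.prems by (auto simp: avg_pair fun_eq_iff field_simps)
  ultimately show ?case by (intro exI[of _ "Edge_Move x y (1/2) # ms"]) (auto simp: apply_moves_def)
qed

lemma edge_moves_affine:
  assumes "\<forall>m\<in>set ms. is_edge_move E m"
  shows "apply_moves ms (\<lambda>u. (1 - t) * \<eta> u + t * \<zeta> u) =
    (\<lambda>u. (1 - t) * apply_moves ms \<eta> u + t * apply_moves ms \<zeta> u)"
  using assms
proof (induction ms arbitrary: \<eta> \<zeta>)
  case (Cons m ms)
  obtain x y \<mu> where m: "m = Edge_Move x y \<mu>" using Cons.prems by (cases m) auto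
  have "apply_move m (\<lambda>u. (1 - t) * \<eta> u + t * \<zeta> u) =
    (\<lambda>u. (1 - t) * apply_move m \<eta> u + t * apply_move m \<zeta> u)"
    by (auto simp: m fun_eq_iff algebra_simps)
  then show ?case using Cons by (simp add: apply_moves_def)
qed (simp add: apply_moves_def)

text \<open>Parameters strictly between \<open>0\<close> and \<open>1/2\<close> are of no use: the final level at \<open>v\<close> is a convex
  combination of the levels obtained by omitting the first move and by performing it completely.\<close>

lemma edge_moves_le_word:
  assumes "\<forall>m\<in>set ms. is_edge_move E m"
  shows "\<exists>w\<in>lists E. apply_moves ms \<eta> v \<le> avgs w \<eta> v"
  using assms
proof (induction ms arbitrary: \<eta>)
  case Nil
  show ?case by (intro bexI[of _ "[]"]) (auto simp: apply_moves_def)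
next
  case (Cons m ms)
  obtain x y \<mu> where m: "m = Edge_Move x y \<mu>" "{x, y} \<in> E" "0 \<le> \<mu>" "\<mu> \<le> 1/2"
    using Cons.prems by (cases m) auto
  have "x \<noteq> y" using edge(2)[OF m(2)] by auto
  then have "apply_move m \<eta> = (\<lambda>u. (1 - 2 * \<mu>) * \<eta> u + 2 * \<mu> * avg {x, y} \<eta> u)"
    by (auto simp: m avg_pair fun_eq_iff field_simps)
  then have eq: "apply_moves (m # ms) \<eta> v =
      (1 - 2 * \<mu>) * apply_moves ms \<eta> v + 2 * \<mu> * apply_moves ms (avg {x, y} \<eta>) v"
    using edge_moves_affine[of ms "2 * \<mu>" \<eta> "avg {x, y} \<eta>"] Cons.prems by (simp add: apply_moves_def)
  obtain w1 where w1: "w1 \<in> lists E" "apply_moves ms \<eta> v \<le> avgs w1 \<eta> v"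
    using Cons.IH[of \<eta>] Cons.prems by auto
  obtain w2 where w2: "w2 \<in> lists E" "apply_moves ms (avg {x, y} \<eta>) v \<le> avgs w2 (avg {x, y} \<eta>) v"
    using Cons.IH[of "avg {x, y} \<eta>"] Cons.prems by auto
  have le: "apply_moves (m # ms) \<eta> v \<le> (1 - 2 * \<mu>) * avgs w1 \<eta> v + 2 * \<mu> * avgs ({x, y} # w2) \<eta> v"
    unfolding eq using m w1 w2 by (intro add_mono mult_left_mono) auto
  have "(1 - 2 * \<mu>) * a + 2 * \<mu> * b \<le> max a b" for a b :: real
    using m by (intro convex_bound_le) auto
  from order_trans[OF le this] have "apply_moves (m # ms) \<eta> v \<le> avgs w1 \<eta> v \<or> 
      apply_moves (m # ms) \<eta> v \<le> avgs ({x, y} # w2) \<eta> v" by (simp only: le_max_iff_disj)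
  then show ?case
  proof
    assume "apply_moves (m # ms) \<eta> v \<le> avgs w1 \<eta> v"
    with w1 show ?thesis by blast
  next
    assume "apply_moves (m # ms) \<eta> v \<le> avgs ({x, y} # w2) \<eta> v"
    moreover have "{x, y} # w2 \<in> lists E" using w2 m by auto
    ultimately show ?thesis by blast
  qed
qed

lemma kappa_attained:
  assumes v: "v \<in> V"
  shows "\<exists>ms. (\<forall>m\<in>set ms. is_edge_move E m \<or> is_hypermove V E m) \<and> apply_moves ms \<eta> v = \<kappa> E \<eta> v"
proof -
  have "nonexpansive V (\<lambda>\<eta>. \<eta> v)" using v by (force simp: nonexpansive_def)
  then obtain h where h: "h \<in> lists connected_sets" "\<And>w. w \<in> lists E \<Longrightarrow> avgs w \<eta> v \<le> avgs h \<eta> v"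
    using dominatedE[OF dominated_lists[OF subset_refl], of "\<lambda>\<eta>. \<eta> v" \<eta>] by blast
  have "\<kappa> E \<eta> v = avgs h \<eta> v"
    unfolding \<kappa>_def
  proof (rule cSup_eq_non_empty)
    show "{apply_moves ms \<eta> v | ms. \<forall>m\<in>set ms. is_edge_move E m} \<noteq> {}"
      by (auto intro: exI[of _ "[]"])
  next
    fix a assume "a \<in> {apply_moves ms \<eta> v | ms. \<forall>m\<in>set ms. is_edge_move E m}"
    then obtain w where "w \<in> lists E" "a \<le> avgs w \<eta> v"
      using edge_moves_le_word[of _ \<eta> v] by blast
    with h(2)[of w] show "a \<le> avgs h \<eta> v" by simp
  next
    fix b assume b: "\<And>a. a \<in> {apply_moves ms \<eta> v | ms. \<forall>m\<in>set ms. is_edge_move E m} \<Longrightarrow> a \<le> b"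
    show "avgs h \<eta> v \<le> b"
    proof (rule field_le_epsilon)
      fix \<epsilon> :: real assume "\<epsilon> > 0"
      then obtain w where w: "w \<in> lists E" "\<bar>avgs h \<eta> v - avgs w \<eta> v\<bar> \<le> \<epsilon>"
        using connected_word_approx[OF h(1), of \<epsilon> \<eta>] v by blast
      obtain ms where "\<forall>m\<in>set ms. is_edge_move E m" "apply_moves ms \<eta> = avgs w \<eta>"
        using edge_word_moves[OF w(1)] by blast
      then have "avgs w \<eta> v \<le> b" using b[of "avgs w \<eta> v"] by force
      with w(2) show "avgs h \<eta> v \<le> b + \<epsilon>" by linarith
    qed
  qed
  then show ?thesis using connected_word_moves[OF h(1)] by metis
qed

end

theorem theorem3p1:
  fixes V :: "'a set" and E :: "'a set set" and c :: real and \<eta>\<^sub>0 :: "'a \<Rightarrow> real" and v :: 'a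
  assumes "finite V" and "simple_graph V E"
    and "c > 0" and "water_profile V c \<eta>\<^sub>0"
    and "v \<in> V"
  shows "\<exists>ms. (\<forall>m\<in>set ms. is_edge_move E m \<or> is_hypermove V E m) \<and>
              apply_moves ms \<eta>\<^sub>0 v = \<kappa> E \<eta>\<^sub>0 v"
proof -
  interpret finite_simple_graph V E by unfold_locales (rule assms)+
  show ?thesis by (rule kappa_attained[OF assms(5)])
qed

end
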